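(* Let $\mathcal{H}$ and $\mathcal{K}$ be real Hilbert spaces, let $f:\mathcal{H}\to\mathbb{R}$ be convex and $L_f$-Lipschitz continuous, let $g:\mathcal{K}\to\mathbb{R}$ be convex and $L_g$-Lipschitz continuous, let $K:\mathcal{H}\to\mathcal{K}$ be a linear continuous operator, put $F(x)=f(x)+g(Kx)$ for $x\in\mathcal{H}$, and let $x^*\in\mathcal{H}$ be an optimal solution of $\inf_{x\in\mathcal{H}}\{f(x)+g(Kx)\}$. Let $a,b>0$, and set $\rho_k=\frac{1}{ak}$ and $\mu_k=\frac{1}{bk}$ for all $k\ge 1$. Let $x_0\in\mathcal{H}$ be arbitrary, and let $(x_k)_{k\ge 1}\subseteq\mathcal{H}$ be generated by the following iteration: $t_1=1$, $y_1=x_0$, and for $k\ge 1$ $$L_k=\frac{1}{\rho_k}+\frac{\|K\|^2}{\mu_k},\qquad x_k=y_k-\frac{1}{L_k}\left(\mathrm{Prox}_{\frac{1}{\rho_k}f^*}\left(\frac{y_k}{\rho_k}\right)+K^*\,\mathrm{Prox}_{\frac{1}{\mu_k}g^*}\left(\frac{Ky_k}{\mu_k}\right)\right),$$ $$t_{k+1}=\frac{1+\sqrt{1+4t_k^2}}{2},\qquad y_{k+1}=x_k+\frac{t_k-1}{t_{k+1}}(x_k-x_{k-1}).$$ Then for all $k\ge 1$ $$F(x_{k+1})-F(x^* )\le \frac{2(a+b\|K\|^2)}{k+2}\|x_0-x^*\|^2+\frac{2(1+\ln(k+1))}{k+2}\left(\frac{L_f^2}{a}+\frac{L_g^2}{b}\right),$$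 and thus the objective values converge to the optimal value with rate $F(x_k)-F(x^* )=\mathcal{O}\left(\frac{\ln k}{k}\right)$.
   Context: For a function $h$ on a real Hilbert space $\mathcal{X}$, $h^*(p)=\sup_{x\in\mathcal{X}}\{\langle p,x\rangle-h(x)\}$ denotes its (Fenchel) conjugate. For a proper, convex, lower semicontinuous $h:\mathcal{X}\to\mathbb{R}\cup\{+\infty\}$ and $\gamma>0$, $\mathrm{Prox}_{\gamma h}(x)$ denotes the unique minimizer over $y\in\mathcal{X}$ of $h(y)+\frac{1}{2\gamma}\|y-x\|^2$. $K^*$ is the adjoint operator of $K$ and $\|K\|$ its operator norm. *)

theory Defs
  imports "HOL-Analysis.Analysis" "HOL-Library.Landau_Symbols"
begin

definition fenchel_conjugate :: "('a::real_inner \<Rightarrow> ereal) \<Rightarrow> 'a \<Rightarrow> ereal" where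
  "fenchel_conjugate h p = (SUP x. ereal (p \<bullet> x) - h x)"

text \<open>\<open>prox \<gamma> h x\<close> is \<open>Prox\<^bsub>\<gamma>h\<^esub>(x)\<close>; it is meaningful when the minimizer exists and is unique,
  as it is for \<open>\<gamma> > 0\<close> and \<open>h\<close> proper, convex and lower semicontinuous on a Hilbert space.\<close>

definition prox :: "real \<Rightarrow> ('a::real_inner \<Rightarrow> ereal) \<Rightarrow> 'a \<Rightarrow> 'a" where
  "prox \<gamma> h x = (THE y. \<forall>z. h y + ereal (1 / (2 * \<gamma>) * (norm (y - x))\<^sup>2)
                             \<le> h z + ereal (1 / (2 * \<gamma>) * (norm (z - x))\<^sup>2))"

end

theory Submission
  imports Defs
begin

text \<open>
  The two proximal points are the gradients of the Moreau envelopes of \<open>f\<close> at \<open>y\<^sub>k\<close> and of \<open>g\<close> at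
  \<open>K y\<^sub>k\<close>, with parameters \<open>\<rho>\<^sub>k\<close> and \<open>\<mu>\<^sub>k\<close>. Let \<open>\<Phi>\<^sub>k\<close> be the sum of the first envelope and the second
  one composed with \<open>K\<close>: the iteration is FISTA on these \<open>L\<^sub>k\<close>-smooth convex functions, with \<open>\<Phi>\<^sub>k \<le> F \<le> \<Phi>\<^sub>k + \<epsilon>\<^sub>k\<close>, \<open>\<epsilon>\<^sub>k = (\<rho>\<^sub>k L\<^sub>f\<^sup>2 + \<mu>\<^sub>k L\<^sub>g\<^sup>2) / 2\<close>. As the parameters decrease,
  \<open>\<Phi>\<^sub>k + \<epsilon>\<^sub>k\<close> decreases pointwise. Hence, with \<open>\<Delta>\<^sub>k = \<Phi>\<^sub>k x\<^sub>k + \<epsilon>\<^sub>k - F x\<^sup>* \<ge> 0\<close>,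
  \<open>u\<^sub>k = t\<^sub>k x\<^sub>k - (t\<^sub>k - 1) x\<^bsub>k-1\<^esub> - x\<^sup>*\<close> and \<open>c = a + b \<parallel>K\<parallel>\<^sup>2\<close> (so \<open>L\<^sub>k = c k\<close>), the FISTA energy divided by
  \<open>k\<close>, namely \<open>t\<^sub>k\<^sup>2 \<Delta>\<^sub>k / k + c \<parallel>u\<^sub>k\<parallel>\<^sup>2 / 2\<close>, grows in step \<open>k\<close> by at most
  \<open>t\<^sub>k \<epsilon>\<^sub>k / k \<le> (L\<^sub>f\<^sup>2 / a + L\<^sub>g\<^sup>2 / b) / (2 k)\<close>. Summing gives a harmonic sum, and
  \<open>t\<^sub>k \<ge> (k + 1) / 2\<close> turns the energy bound into the stated rate.
\<close>

section \<open>Proximal points of a convex Lipschitz function: existence and optimality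
  condition\<close>

lemma power2_norm_add_scaleR:
  fixes u w :: "'a::real_inner"
  shows "(norm (u + c *\<^sub>R w))\<^sup>2 = (norm u)\<^sup>2 + 2 * c * (u \<bullet> w) + c\<^sup>2 * (norm w)\<^sup>2"
  unfolding power2_norm_eq_inner
  by (simp add: inner_add_left inner_add_right inner_commute power2_eq_square)

lemma power2_norm_diff_scaleR:
  fixes u w :: "'a::real_inner"
  shows "(norm (u - c *\<^sub>R w))\<^sup>2 = (norm u)\<^sup>2 - 2 * c * (u \<bullet> w) + c\<^sup>2 * (norm w)\<^sup>2"
  using power2_norm_add_scaleR[of u "- c" w] by simp

text \<open>Young's inequality absorbs the Lipschitz loss \<open>M * norm (z - x)\<close> into the
  quadratic term. The bound serves twice: for the existence of minimizers and for the approximation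
  error of the envelope.\<close>

lemma moreau_objective_bounded_below:
  fixes f :: "'a::real_inner \<Rightarrow> real"
  assumes lip: "lipschitz_on M UNIV f" and "\<rho> > 0"
  shows "f x - \<rho> * M\<^sup>2 / 2 \<le> f z + (norm (z - x))\<^sup>2 / (2 * \<rho>)"
proof -
  have "\<bar>f z - f x\<bar> \<le> M * norm (z - x)"
    using lipschitz_onD[OF lip, of z x] by (simp add: dist_norm)
  moreover have "0 \<le> (\<rho> * M - norm (z - x))\<^sup>2 / (2 * \<rho>)"
    using \<open>\<rho> > 0\<close> by simp
  then have "M * norm (z - x) \<le> \<rho> * M\<^sup>2 / 2 + (norm (z - x))\<^sup>2 / (2 * \<rho>)"
    using \<open>\<rho> > 0\<close> by (simp add: field_simps power2_eq_square)
  ultimately show ?thesis by linarith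
qed

text \<open>The quadratic term makes the objective strongly convex, so a minimizing sequence is
  Cauchy; completeness provides its limit and continuity of \<open>f\<close> makes the limit a
  minimizer.\<close>

lemma moreau_minimizer_exists:
  fixes f :: "'a::{real_inner, complete_space} \<Rightarrow> real"
  assumes conv: "convex_on UNIV f" and lip: "lipschitz_on M UNIV f" and \<rho>: "\<rho> > 0"
  obtains v where "\<And>z. f v + (norm (v - x))\<^sup>2 / (2 * \<rho>) \<le> f z + (norm (z - x))\<^sup>2 / (2 * \<rho>)"
proof -
  define \<phi> where "\<phi> z = f z + (norm (z - x))\<^sup>2 / (2 * \<rho>)" for z
  define m where "m = (INF z. \<phi> z)"
  have bdd: "bdd_below (range \<phi>)"
    using moreau_objective_bounded_below[OF lip \<rho>, of x]
    by (auto simp: bdd_below_def \<phi>_def)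
  have m_le: "m \<le> \<phi> z" for z
    unfolding m_def using bdd by (simp add: cINF_lower)
  \<comment> \<open>The midpoint of \<open>u\<close> and \<open>w\<close> still has objective value
    at least \<open>m\<close>. By the parallelogram identity it gains a quarter of the squared
    distance, and \<open>1 / (2 * \<rho>)\<close> times that quarter gives the factor
    \<open>8 * \<rho>\<close>.\<close>
  have midpoint: "(norm (u - w))\<^sup>2 \<le> 8 * \<rho> * ((\<phi> u + \<phi> w) / 2 - m)" for u w
  proof -
    let ?c = "(1 - 1/2) *\<^sub>R u + (1/2) *\<^sub>R w"
    have "f ?c \<le> (1 - 1/2) * f u + (1/2) * f w"
      by (rule convex_onD[OF conv]) auto
    moreover have c: "?c - x = (1/2) *\<^sub>R ((u - x) + (w - x))"
      by (simp add: algebra_simps) (simp flip: scaleR_left_distrib)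
    have uw: "u - w = (u - x) + (-1) *\<^sub>R (w - x)" by simp
    have "(norm (?c - x))\<^sup>2 = (norm ((u - x) + 1 *\<^sub>R (w - x)))\<^sup>2 / 4"
      unfolding c by (simp add: power_divide)
    then have "(norm (?c - x))\<^sup>2 = (norm (u - x))\<^sup>2 / 2 + (norm (w - x))\<^sup>2 / 2 - (norm (u - w))\<^sup>2 / 4"
      unfolding uw power2_norm_add_scaleR by (simp add: field_simps)
    moreover have "m \<le> f ?c + (norm (?c - x))\<^sup>2 / (2 * \<rho>)"
      using m_le[of ?c] by (simp only: \<phi>_def)
    ultimately have "m \<le> f u / 2 + f w / 2
        + ((norm (u - x))\<^sup>2 / 2 + (norm (w - x))\<^sup>2 / 2 - (norm (u - w))\<^sup>2 / 4) / (2 * \<rho>)"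
      by simp
    then have "(norm (u - w))\<^sup>2 / (8 * \<rho>) \<le> (\<phi> u + \<phi> w) / 2 - m"
      by (simp add: \<phi>_def add_divide_distrib diff_divide_distrib)
    then show ?thesis
      using \<rho> by (simp add: divide_le_eq mult.commute)
  qed
  have "\<exists>z. \<phi> z < m + 1 / real (Suc n)" for n
    using cINF_less_iff[of UNIV \<phi> "m + 1 / real (Suc n)"] bdd by (auto simp: m_def)
  then obtain z where z: "\<And>n. \<phi> (z n) < m + 1 / real (Suc n)" by metis
  have "Cauchy z"
  proof (rule CauchyI)
    fix e :: real assume "0 < e"
    \<comment> \<open>\<open>N\<close> is chosen so that
      \<open>8 * \<rho> / real (Suc N) < e\<^sup>2\<close>, which is what \<open>midpoint\<close>
      asks for.\<close>
    obtain N where "8 * \<rho> / e\<^sup>2 < real N"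
      using reals_Archimedean2 by blast
    then have N: "8 * \<rho> / e\<^sup>2 < real (Suc N)" by simp
    have "norm (z i - z j) < e" if "i \<ge> N" "j \<ge> N" for i j
    proof -
      define d where "d = 1 / real (Suc N)"
      have "1 / real (Suc n) \<le> d" if "n \<ge> N" for n
        unfolding d_def using that by (intro frac_le) auto
      then have "\<phi> (z i) < m + d" "\<phi> (z j) < m + d"
        using z[of i] z[of j] that by fastforce+
      then have "(\<phi> (z i) + \<phi> (z j)) / 2 - m < d" by (simp add: field_simps)
      with \<rho> have "8 * \<rho> * ((\<phi> (z i) + \<phi> (z j)) / 2 - m) < 8 * \<rho> * d"
        by (intro mult_strict_left_mono) auto
      with midpoint[of "z i" "z j"] have "(norm (z i - z j))\<^sup>2 < 8 * \<rho> * d"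
        by (rule le_less_trans)
      also have "8 * \<rho> * d = 8 * \<rho> / real (Suc N)"
        by (simp add: d_def)
      also have "\<dots> < e\<^sup>2"
        using N \<open>0 < e\<close> by (simp add: field_simps)
      finally show ?thesis
        using \<open>0 < e\<close> by (simp add: power2_less_imp_less)
    qed
    then show "\<exists>N. \<forall>i\<ge>N. \<forall>j\<ge>N. norm (z i - z j) < e" by blast
  qed
  then obtain v where v: "z \<longlonglongrightarrow> v"
    using Cauchy_convergent convergent_def by blast
  have "(\<lambda>n. f (z n)) \<longlonglongrightarrow> f v"
    using lipschitz_on_continuous_on[OF lip] v
    by (auto simp: continuous_on_eq_continuous_at isCont_tendsto_compose)
  then have "(\<lambda>n. \<phi> (z n)) \<longlonglongrightarrow> \<phi> v"
    unfolding \<phi>_def using \<rho> by (intro tendsto_intros v) auto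
  moreover have "(\<lambda>n. m + 1 / real (Suc n)) \<longlonglongrightarrow> m + 0"
    by (intro tendsto_intros LIMSEQ_Suc[OF lim_1_over_n])
  ultimately have "\<phi> v \<le> m + 0"
    by (rule LIMSEQ_le) (use z less_imp_le in blast)
  then have "\<phi> v \<le> \<phi> z" for z
    using m_le[of z] by simp
  then show ?thesis
    using that unfolding \<phi>_def by blast
qed

text \<open>Moving from \<open>v\<close> a fraction \<open>s\<close> towards \<open>z\<close> cannot
  lower the objective. Convexity bounds the change of \<open>f\<close>; dividing by \<open>s\<close>
  and letting \<open>s\<close> tend to 0 removes the second-order term \<open>s * N\<close>.\<close>

lemma moreau_minimizer_subgradient:
  fixes f :: "'a::real_inner \<Rightarrow> real"
  assumes conv: "convex_on UNIV f" and \<rho>: "\<rho> > 0"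
    and min: "\<And>z. f v + (norm (v - x))\<^sup>2 / (2 * \<rho>) \<le> f z + (norm (z - x))\<^sup>2 / (2 * \<rho>)"
  shows "f v + ((1 / \<rho>) *\<^sub>R (x - v)) \<bullet> (z - v) \<le> f z"
proof -
  define N where "N = (norm (z - v))\<^sup>2 / (2 * \<rho>)"
  define B where "B = (v - x) \<bullet> (z - v) / \<rho>"
  define q where "q = f z - f v + B"
  have key: "0 \<le> q + s * N" if s: "0 < s" "s < 1" for s
  proof -
    let ?c = "(1 - s) *\<^sub>R v + s *\<^sub>R z"
    have "f ?c \<le> (1 - s) * f v + s * f z"
      using s by (intro convex_onD[OF conv]) auto
    moreover have c: "?c - x = (v - x) + s *\<^sub>R (z - v)"
      by (simp add: algebra_simps)
    have "(norm (?c - x))\<^sup>2 / (2 * \<rho>) = (norm (v - x))\<^sup>2 / (2 * \<rho>) + s * B + s * (s * N)"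
      unfolding c power2_norm_add_scaleR B_def N_def
      by (simp add: add_divide_distrib power2_eq_square)
    ultimately have "0 \<le> s * (f z - f v) + s * B + s * (s * N)"
      using min[of ?c] by (simp add: algebra_simps)
    then have "0 \<le> s * (q + s * N)"
      by (simp add: q_def algebra_simps)
    then show ?thesis using s by (simp add: zero_le_mult_iff)
  qed
  have "((\<lambda>s. q + s * N) \<longlongrightarrow> q + 0 * N) (at_right 0)"
    by (intro tendsto_intros)
  moreover have "\<forall>\<^sub>F s in at_right 0. 0 \<le> q + s * N"
    by (rule eventually_mono[OF eventually_at_right_real[of 0 "1::real"]]) (auto intro: key)
  ultimately have "0 \<le> q"
    using tendsto_lowerbound[of _ _ "at_right (0::real)"] by simp
  moreover have "((1 / \<rho>) *\<^sub>R (x - v)) \<bullet> (z - v) = - B"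
    using inner_minus_left[of "x - v" "z - v"] by (simp add: B_def)
  ultimately show ?thesis by (simp add: q_def)
qed

section \<open>The adjoint of a bounded operator on a Hilbert space\<close>

text \<open>The Riesz representative of \<open>z \<mapsto> K z \<bullet> w\<close> is the minimizer of \<open>\<parallel>z\<parallel>\<^sup>2 / 2 - K z \<bullet> w\<close>.\<close>

lemma inner_adjoint_Hilbert:
  fixes K :: "'a::{real_inner, complete_space} \<Rightarrow> 'b::real_inner"
  assumes K: "bounded_linear K"
  shows "z \<bullet> adjoint K w = K z \<bullet> w"
proof -
  interpret bounded_linear K by (rule K)
  have "\<exists>v. \<forall>z. K z \<bullet> w = z \<bullet> v" for w
  proof -
    define f where "f z = - (K z \<bullet> w)" for z
    have "convex_on UNIV f"
      by (rule convex_onI) (auto simp: f_def add scaleR inner_add_left)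
    moreover have "lipschitz_on (onorm K * norm w) UNIV f"
    proof (rule lipschitz_onI)
      fix u z :: 'a
      have "dist (f u) (f z) = \<bar>K (z - u) \<bullet> w\<bar>"
        by (simp add: f_def dist_real_def diff inner_diff_left)
      also have "\<dots> \<le> norm (K (z - u)) * norm w"
        by (rule Cauchy_Schwarz_ineq2)
      also have "\<dots> \<le> (onorm K * norm (z - u)) * norm w"
        by (intro mult_right_mono onorm[OF K]) auto
      finally show "dist (f u) (f z) \<le> onorm K * norm w * dist u z"
        by (simp add: dist_norm norm_minus_commute mult_ac)
    qed (simp add: onorm_pos_le[OF K])
    ultimately obtain v where
      v: "\<And>z. f v + (norm (v - 0))\<^sup>2 / (2 * 1) \<le> f z + (norm (z - 0))\<^sup>2 / (2 * 1)"
      using moreau_minimizer_exists[OF _ _ zero_less_one, of f _ 0] by blast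
    \<comment> \<open>For this linear \<open>f\<close>, with parameter 1 and centre 0, the
      subgradient at the minimizer is \<open>- v\<close>. Applying the inequality to
      \<open>h\<close> and \<open>- h\<close> forces equality.\<close>
    have le: "K h \<bullet> w \<le> h \<bullet> v" for h
      using moreau_minimizer_subgradient[OF \<open>convex_on UNIV f\<close> zero_less_one v, of "v + h"]
      by (simp add: f_def add inner_add_left inner_commute[of v])
    have "K h \<bullet> w = h \<bullet> v" for h
      using le[of h] le[of "- h"] by (simp add: neg)
    then show ?thesis by blast
  qed
  \<comment> \<open>\<open>adjoint\<close> selects some map with the defining identity, so one such
    map has to be exhibited first.\<close>
  then have "\<exists>K'. \<forall>w. \<forall>z. K z \<bullet> w = z \<bullet> K' w"
    by (intro choice allI)
  then obtain K' where K': "\<And>w z. K z \<bullet> w = z \<bullet> K' w" by blast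
  then have "adjoint K = K'"
    by (intro adjoint_unique allI)
  with K' show ?thesis by simp
qed

section \<open>The Moreau envelope, with its gradient expressed by the prox of the conjugate\<close>

text \<open>\<open>smoothing \<rho> f\<close> is the Moreau envelope \<open>x \<mapsto> min\<^sub>v f v + \<parallel>x - v\<parallel>\<^sup>2 / (2\<rho>)\<close>, whose
  minimizer is \<open>v = x - \<rho> p\<close> with \<open>p = smoothing_grad \<rho> f x\<close>.\<close>

definition smoothing_grad :: "real \<Rightarrow> ('a::real_inner \<Rightarrow> real) \<Rightarrow> 'a \<Rightarrow> 'a" where
  "smoothing_grad \<rho> f x =
     prox (1 / \<rho>) (fenchel_conjugate (\<lambda>u. ereal (f u))) ((1 / \<rho>) *\<^sub>R x)"

definition smoothing :: "real \<Rightarrow> ('a::real_inner \<Rightarrow> real) \<Rightarrow> 'a \<Rightarrow> real" where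
  "smoothing \<rho> f x = f (x - \<rho> *\<^sub>R smoothing_grad \<rho> f x) + \<rho> / 2 * (norm (smoothing_grad \<rho> f x))\<^sup>2"

lemma fenchel_conjugate_ge: "ereal (p \<bullet> v - f v) \<le> fenchel_conjugate (\<lambda>u. ereal (f u)) p"
  unfolding fenchel_conjugate_def by (rule SUP_upper2[of v]) auto

lemma fenchel_conjugate_subgradient:
  assumes "\<And>z. f v + p \<bullet> (z - v) \<le> f z"
  shows "fenchel_conjugate (\<lambda>u. ereal (f u)) p = ereal (p \<bullet> v - f v)"
proof (rule antisym[OF _ fenchel_conjugate_ge])
  have "p \<bullet> z - f z \<le> p \<bullet> v - f v" for z
    using assms[of z] by (simp add: inner_diff_right)
  then show "fenchel_conjugate (\<lambda>u. ereal (f u)) p \<le> ereal (p \<bullet> v - f v)"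
    unfolding fenchel_conjugate_def by (intro SUP_least) auto
qed

text \<open>This is Moreau's decomposition: a subgradient \<open>p\<close> of \<open>f\<close> at
  \<open>x - \<rho> *\<^sub>R p\<close> attains equality in Fenchel-Young there, which is the
  optimality condition for the conjugate prox.\<close>

lemma prox_fenchel_conjugate_eqI:
  fixes f :: "'a::real_inner \<Rightarrow> real"
  assumes \<rho>: "\<rho> > 0" and sub: "\<And>z. f (x - \<rho> *\<^sub>R p) + p \<bullet> (z - (x - \<rho> *\<^sub>R p)) \<le> f z"
  shows "prox (1 / \<rho>) (fenchel_conjugate (\<lambda>u. ereal (f u))) ((1 / \<rho>) *\<^sub>R x) = p"
proof -
  define v where "v = x - \<rho> *\<^sub>R p"
  define h where "h = fenchel_conjugate (\<lambda>u. ereal (f u))"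
  define N where "N q = 1 / (2 * (1 / \<rho>)) * (norm (q - (1 / \<rho>) *\<^sub>R x))\<^sup>2" for q
  have hp: "h p = ereal (p \<bullet> v - f v)"
    unfolding h_def using sub by (intro fenchel_conjugate_subgradient) (simp add: v_def)
  \<comment> \<open>Since \<open>x - v = \<rho> *\<^sub>R p\<close>, adding the linear term moves
    the centre of the square \<open>N\<close> from \<open>(1 / \<rho>) *\<^sub>R x\<close> to
    \<open>p\<close>.\<close>
  have N: "q \<bullet> v + N q = p \<bullet> v + N p + \<rho> / 2 * (norm (q - p))\<^sup>2" for q
  proof -
    have N_eq: "N r = \<rho> / 2 * (norm (r - p))\<^sup>2 - (r - p) \<bullet> v + (norm v)\<^sup>2 / (2 * \<rho>)" for r
    proof -
      have r: "r - (1 / \<rho>) *\<^sub>R x = (r - p) - (1 / \<rho>) *\<^sub>R v"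
        using \<rho> by (simp add: v_def algebra_simps)
      show ?thesis
        unfolding N_def r power2_norm_diff_scaleR using \<rho>
        by (simp add: field_simps power2_eq_square)
    qed
    show ?thesis
      unfolding N_eq by (simp add: inner_diff_left)
  qed
  \<comment> \<open>Fenchel-Young at \<open>v\<close> holds for every \<open>q\<close>, with
    equality at \<open>p\<close>. The remaining quadratic growth yields both minimality and the
    uniqueness that \<open>THE\<close> requires.\<close>
  have lower: "h p + ereal (N p) + ereal (\<rho> / 2 * (norm (q - p))\<^sup>2) \<le> h q + ereal (N q)" for q
  proof -
    have "h p + ereal (N p) + ereal (\<rho> / 2 * (norm (q - p))\<^sup>2) = ereal (q \<bullet> v - f v) + ereal (N q)"
      using N[of q] by (simp add: hp)
    also have "\<dots> \<le> h q + ereal (N q)"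
      unfolding h_def by (intro add_right_mono fenchel_conjugate_ge)
    finally show ?thesis .
  qed
  have "(THE q. \<forall>z. h q + ereal (N q) \<le> h z + ereal (N z)) = p"
  proof (rule the_equality)
    show "\<forall>z. h p + ereal (N p) \<le> h z + ereal (N z)"
    proof
      fix z
      have "h p + ereal (N p) \<le> h p + ereal (N p) + ereal (\<rho> / 2 * (norm (z - p))\<^sup>2)"
        using \<rho> by (simp add: hp)
      with lower[of z] show "h p + ereal (N p) \<le> h z + ereal (N z)" by (rule order_trans[rotated])
    qed
  next
    fix q assume "\<forall>z. h q + ereal (N q) \<le> h z + ereal (N z)"
    then have "h p + ereal (N p) + ereal (\<rho> / 2 * (norm (q - p))\<^sup>2) \<le> h p + ereal (N p)"
      using lower[of q] order_trans by blast
    then have "\<rho> / 2 * (norm (q - p))\<^sup>2 \<le> 0" by (simp add: hp)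
    then show "q = p" using \<rho> by (simp add: mult_le_0_iff)
  qed
  then show ?thesis unfolding prox_def h_def N_def .
qed

text \<open>The minimizer \<open>v\<close> supplies the subgradient
  \<open>(1 / \<rho>) *\<^sub>R (x - v)\<close> that identifies the prox. All later properties of
  the envelope rest on this inequality.\<close>

lemma smoothing_grad_subgradient:
  fixes f :: "'a::{real_inner, complete_space} \<Rightarrow> real"
  assumes "convex_on UNIV f" "lipschitz_on M UNIV f" "\<rho> > 0"
  shows "f (x - \<rho> *\<^sub>R smoothing_grad \<rho> f x)
      + smoothing_grad \<rho> f x \<bullet> (z - (x - \<rho> *\<^sub>R smoothing_grad \<rho> f x)) \<le> f z"
proof -
  obtain v where v: "\<And>z. f v + (norm (v - x))\<^sup>2 / (2 * \<rho>) \<le> f z + (norm (z - x))\<^sup>2 / (2 * \<rho>)"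
    using moreau_minimizer_exists[OF assms] by blast
  define p where "p = (1 / \<rho>) *\<^sub>R (x - v)"
  have v_eq: "x - \<rho> *\<^sub>R p = v" using \<open>\<rho> > 0\<close> by (simp add: p_def)
  have sub: "f (x - \<rho> *\<^sub>R p) + p \<bullet> (z - (x - \<rho> *\<^sub>R p)) \<le> f z" for z
    unfolding v_eq unfolding p_def by (rule moreau_minimizer_subgradient[OF assms(1,3) v])
  then have "smoothing_grad \<rho> f x = p"
    unfolding smoothing_grad_def by (rule prox_fenchel_conjugate_eqI[OF \<open>\<rho> > 0\<close>])
  with sub[of z] show ?thesis by (simp only:)
qed

text \<open>Testing the subgradient inequality in the direction \<open>p\<close> itself gives
  \<open>(norm p)\<^sup>2 \<le> M * norm p\<close>.\<close>

lemma norm_subgradient_le: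
  fixes f :: "'a::real_inner \<Rightarrow> real"
  assumes lip: "lipschitz_on M UNIV f" and sub: "\<And>z. f v + p \<bullet> (z - v) \<le> f z"
  shows "norm p \<le> M"
proof -
  have "norm p * norm p \<le> f (v + p) - f v"
    using sub[of "v + p"] by (simp add: power2_norm_eq_inner flip: power2_eq_square)
  also have "\<dots> \<le> M * norm p"
    using lipschitz_onD[OF lip, of "v + p" v] by (simp add: dist_norm)
  finally show ?thesis
    using lipschitz_on_nonneg[OF lip] by (cases "p = 0") auto
qed

text \<open>The subgradient inequality at the proximal point, with a completed square, shows that
  the envelope value is a minimum over \<open>v\<close>. The choice \<open>v = x\<close> puts the
  envelope below \<open>f\<close>.\<close>

lemma smoothing_le:
  fixes f :: "'a::{real_inner, complete_space} \<Rightarrow> real"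
  assumes "convex_on UNIV f" "lipschitz_on M UNIV f" "\<rho> > 0"
  shows "smoothing \<rho> f x \<le> f v + (norm (x - v))\<^sup>2 / (2 * \<rho>)"
proof -
  define p where "p = smoothing_grad \<rho> f x"
  have "f (x - \<rho> *\<^sub>R p) + p \<bullet> (v - (x - \<rho> *\<^sub>R p)) \<le> f v"
    unfolding p_def by (rule smoothing_grad_subgradient[OF assms])
  moreover have "0 \<le> (norm ((x - v) - \<rho> *\<^sub>R p))\<^sup>2 / (2 * \<rho>)" using \<open>\<rho> > 0\<close> by simp
  moreover have "(norm ((x - v) - \<rho> *\<^sub>R p))\<^sup>2 / (2 * \<rho>)
      = \<rho> / 2 * (norm p)\<^sup>2 - p \<bullet> (x - v) + (norm (x - v))\<^sup>2 / (2 * \<rho>)"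
    unfolding power2_norm_diff_scaleR inner_commute[of "x - v" p] using \<open>\<rho> > 0\<close>
    by (simp add: field_simps power2_eq_square)
  moreover have "p \<bullet> (v - (x - \<rho> *\<^sub>R p)) = \<rho> * (norm p)\<^sup>2 - p \<bullet> (x - v)"
    unfolding power2_norm_eq_inner by (simp add: inner_diff_right)
  ultimately show ?thesis
    unfolding smoothing_def p_def[symmetric] by linarith
qed

text \<open>The proximal point of \<open>x\<close> is used as a competitor in the minimum defining
  the envelope at \<open>z\<close>; no differentiation is involved.\<close>

lemma smoothing_quadratic_upper_bound:
  fixes f :: "'a::{real_inner, complete_space} \<Rightarrow> real"
  assumes "convex_on UNIV f" "lipschitz_on M UNIV f" "\<rho> > 0"
  shows "smoothing \<rho> f z
    \<le> smoothing \<rho> f x + smoothing_grad \<rho> f x \<bullet> (z - x) + (norm (z - x))\<^sup>2 / (2 * \<rho>)"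
proof -
  define p where "p = smoothing_grad \<rho> f x"
  have "smoothing \<rho> f z \<le> f (x - \<rho> *\<^sub>R p) + (norm (z - (x - \<rho> *\<^sub>R p)))\<^sup>2 / (2 * \<rho>)"
    by (rule smoothing_le[OF assms])
  moreover have "z - (x - \<rho> *\<^sub>R p) = (z - x) + \<rho> *\<^sub>R p" by simp
  then have "(norm (z - (x - \<rho> *\<^sub>R p)))\<^sup>2 / (2 * \<rho>)
      = (norm (z - x))\<^sup>2 / (2 * \<rho>) + p \<bullet> (z - x) + \<rho> / 2 * (norm p)\<^sup>2"
    using \<open>\<rho> > 0\<close>
    by (simp only: power2_norm_add_scaleR inner_commute[of "z - x" p])
       (simp add: field_simps power2_eq_square)
  ultimately show ?thesis
    unfolding smoothing_def[of \<rho> f x] p_def[symmetric] by linarith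
qed

text \<open>The subgradient at one proximal point is tested at the other; the quadratic terms are
  compared through \<open>0 \<le> (norm (p - q))\<^sup>2\<close>.\<close>

lemma smoothing_linear_lower_bound:
  fixes f :: "'a::{real_inner, complete_space} \<Rightarrow> real"
  assumes "convex_on UNIV f" "lipschitz_on M UNIV f" "\<rho> > 0"
  shows "smoothing \<rho> f x + smoothing_grad \<rho> f x \<bullet> (z - x) \<le> smoothing \<rho> f z"
proof -
  define p where "p = smoothing_grad \<rho> f x"
  define q where "q = smoothing_grad \<rho> f z"
  have "f (x - \<rho> *\<^sub>R p) + p \<bullet> ((z - \<rho> *\<^sub>R q) - (x - \<rho> *\<^sub>R p)) \<le> f (z - \<rho> *\<^sub>R q)"
    unfolding p_def by (rule smoothing_grad_subgradient[OF assms])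
  moreover have "0 \<le> \<rho> / 2 * (norm (p - q))\<^sup>2" using \<open>\<rho> > 0\<close> by simp
  then have "p \<bullet> (z - x) + \<rho> / 2 * (norm p)\<^sup>2
      \<le> p \<bullet> ((z - \<rho> *\<^sub>R q) - (x - \<rho> *\<^sub>R p)) + \<rho> / 2 * (norm q)\<^sup>2"
    unfolding power2_norm_eq_inner
    by (simp add: inner_diff_left inner_diff_right inner_commute algebra_simps)
  ultimately show ?thesis
    unfolding smoothing_def p_def[symmetric] q_def[symmetric] by linarith
qed

lemma le_smoothing:
  fixes f :: "'a::{real_inner, complete_space} \<Rightarrow> real"
  assumes "convex_on UNIV f" "lipschitz_on M UNIV f" "\<rho> > 0"
  shows "f x \<le> smoothing \<rho> f x + \<rho> * M\<^sup>2 / 2"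
proof -
  define p where "p = smoothing_grad \<rho> f x"
  have "(norm ((x - \<rho> *\<^sub>R p) - x))\<^sup>2 / (2 * \<rho>) = \<rho> / 2 * (norm p)\<^sup>2"
    using \<open>\<rho> > 0\<close> by (simp add: power_mult_distrib power2_eq_square)
  then show ?thesis
    using moreau_objective_bounded_below[OF assms(2,3), of x "x - \<rho> *\<^sub>R p"]
    unfolding smoothing_def p_def[symmetric] by linarith
qed

text \<open>Heuristically, the derivative of the envelope in its parameter is minus half the squared
  gradient norm, hence at least \<open>- M\<^sup>2 / 2\<close>. The proof tests the subgradient
  \<open>q\<close> at the proximal point for \<open>\<rho>\<close>.\<close>

lemma smoothing_parameter_change:
  fixes f :: "'a::{real_inner, complete_space} \<Rightarrow> real"
  assumes f: "convex_on UNIV f" "lipschitz_on M UNIV f" and "0 < \<rho>'" "\<rho>' \<le> \<rho>"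
  shows "smoothing \<rho>' f x \<le> smoothing \<rho> f x + (\<rho> - \<rho>') * M\<^sup>2 / 2"
proof -
  define p where "p = smoothing_grad \<rho> f x"
  define q where "q = smoothing_grad \<rho>' f x"
  have sub: "f (x - \<rho>' *\<^sub>R q) + q \<bullet> (z - (x - \<rho>' *\<^sub>R q)) \<le> f z" for z
    unfolding q_def by (rule smoothing_grad_subgradient[OF f \<open>0 < \<rho>'\<close>])
  have "(norm q)\<^sup>2 \<le> M\<^sup>2"
    using norm_subgradient_le[OF f(2) sub] by (simp add: power_mono)
  then have "(\<rho> - \<rho>') / 2 * (norm q)\<^sup>2 \<le> (\<rho> - \<rho>') / 2 * M\<^sup>2"
    using \<open>\<rho>' \<le> \<rho>\<close> by (intro mult_left_mono) auto
  moreover have "0 \<le> \<rho> / 2 * (norm (p - 1 *\<^sub>R q))\<^sup>2" using \<open>0 < \<rho>'\<close> \<open>\<rho>' \<le> \<rho>\<close> by simp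
  then have "0 \<le> \<rho> / 2 * (norm p)\<^sup>2 - \<rho> * (p \<bullet> q) + \<rho> / 2 * (norm q)\<^sup>2"
    unfolding power2_norm_diff_scaleR by (simp add: algebra_simps)
  moreover have "q \<bullet> ((x - \<rho> *\<^sub>R p) - (x - \<rho>' *\<^sub>R q)) = \<rho>' * (norm q)\<^sup>2 - \<rho> * (p \<bullet> q)"
    unfolding power2_norm_eq_inner by (simp add: inner_diff_right inner_commute)
  ultimately show ?thesis
    using sub[of "x - \<rho> *\<^sub>R p"]
    unfolding smoothing_def p_def[symmetric] q_def[symmetric]
    by (simp add: left_diff_distrib diff_divide_distrib)
qed

section \<open>The accelerated gradient step and its extrapolation parameters\<close>

text \<open>The linear lower bounds at the previous iterate \<open>w\<close> and the reference point
  \<open>z\<close> are weighted by \<open>t\<^sup>2 - t\<close> and \<open>t\<close>, so that their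
  gradient terms add up to \<open>- t * (s \<bullet> G)\<close>. The step shifts \<open>s\<close> by
  \<open>- (t / L) *\<^sub>R G\<close>, and the change of its squared norm accounts for exactly this
  term.\<close>

lemma accelerated_gradient_step:
  fixes \<Phi> :: "'a::real_inner \<Rightarrow> real"
  assumes L: "L > 0" and t: "t \<ge> 1" and x: "x = y - (1 / L) *\<^sub>R G"
    and upper: "\<Phi> x \<le> \<Phi> y + G \<bullet> (x - y) + L / 2 * (norm (x - y))\<^sup>2"
    and lower: "\<And>z. \<Phi> y + G \<bullet> (z - y) \<le> \<Phi> z"
  shows "t\<^sup>2 * \<Phi> x \<le> (t\<^sup>2 - t) * \<Phi> w + t * \<Phi> z
    + L / 2 * ((norm (t *\<^sub>R y - (t - 1) *\<^sub>R w - z))\<^sup>2 - (norm (t *\<^sub>R x - (t - 1) *\<^sub>R w - z))\<^sup>2)"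
proof -
  define s where "s = t *\<^sub>R y - (t - 1) *\<^sub>R w - z"
  have u: "t *\<^sub>R x - (t - 1) *\<^sub>R w - z = s - (t / L) *\<^sub>R G"
    by (simp add: s_def x algebra_simps)
  have "L / 2 * ((norm s)\<^sup>2 - (norm (s - (t / L) *\<^sub>R G))\<^sup>2) = t * (s \<bullet> G) - t\<^sup>2 * ((norm G)\<^sup>2 / (2 * L))"
    unfolding power2_norm_diff_scaleR using L by (simp add: field_simps power2_eq_square)
  moreover have "\<Phi> x \<le> \<Phi> y - (norm G)\<^sup>2 / (2 * L)"
  proof -
    have xy: "x - y = - ((1 / L) *\<^sub>R G)" by (simp add: x)
    have "G \<bullet> (x - y) = - (norm G)\<^sup>2 / L"
      unfolding xy by (simp add: power2_norm_eq_inner)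
    moreover have "L / 2 * (norm (x - y))\<^sup>2 = (norm G)\<^sup>2 / (2 * L)"
      unfolding xy using L by (simp add: power_divide power2_eq_square)
    ultimately show ?thesis using upper by (simp add: field_simps)
  qed
  then have "t\<^sup>2 * \<Phi> x \<le> t\<^sup>2 * (\<Phi> y - (norm G)\<^sup>2 / (2 * L))"
    by (intro mult_left_mono) auto
  moreover have "(t\<^sup>2 - t) * (\<Phi> y + G \<bullet> (w - y)) \<le> (t\<^sup>2 - t) * \<Phi> w"
    using t by (intro mult_left_mono lower) (simp add: power2_eq_square)
  moreover have "t * (\<Phi> y + G \<bullet> (z - y)) \<le> t * \<Phi> z"
    using t by (intro mult_left_mono lower) simp
  moreover have "(t\<^sup>2 - t) * (\<Phi> y + G \<bullet> (w - y)) + t * (\<Phi> y + G \<bullet> (z - y)) = t\<^sup>2 * \<Phi> y - t * (s \<bullet> G)"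
    unfolding s_def inner_commute[of _ G]
    by (simp add: inner_diff_right power2_eq_square algebra_simps)
  ultimately show ?thesis
    unfolding u s_def[symmetric] by (simp add: right_diff_distrib)
qed

text \<open>The recursion picks the larger root of \<open>r\<^sup>2 - r = (t k)\<^sup>2\<close>;
  this lets the weight of the old gap match the previous energy.\<close>

lemma fista_parameter_identity:
  assumes "\<And>k. k \<ge> 1 \<Longrightarrow> t (k + 1) = (1 + sqrt (1 + 4 * (t k)\<^sup>2)) / 2" and "k \<ge> 1"
  shows "(t (k + 1))\<^sup>2 - t (k + 1) = (t k :: real)\<^sup>2"
proof -
  define r where "r = sqrt (1 + 4 * (t k)\<^sup>2)"
  have "r\<^sup>2 = 1 + 4 * (t k)\<^sup>2" by (simp add: r_def)
  moreover have "t (k + 1) = (1 + r) / 2"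
    unfolding r_def by (rule assms(1)[OF assms(2)])
  ultimately show ?thesis
    by (simp only:) (simp add: power2_eq_square field_simps)
qed

text \<open>Each increment lies between 1/2 and 1. The lower bound gives the rate, the upper bound
  controls the smoothing error \<open>t k * \<epsilon> k\<close>.\<close>

lemma fista_parameter_bounds:
  assumes "t 1 = 1" and "\<And>k. k \<ge> 1 \<Longrightarrow> t (k + 1) = (1 + sqrt (1 + 4 * (t k)\<^sup>2)) / 2" and "k \<ge> 1"
  shows "(real k + 1) / 2 \<le> t k \<and> t k \<le> real k"
  using \<open>k \<ge> 1\<close>
proof (induction k rule: dec_induct)
  case base
  then show ?case using assms(1) by simp
next
  case (step k)
  have "2 * t k \<le> sqrt (1 + 4 * (t k)\<^sup>2)"
    by (rule real_le_rsqrt) (simp add: power_mult_distrib)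
  moreover have "sqrt (1 + 4 * (t k)\<^sup>2) \<le> 1 + 2 * t k"
    using step by (intro real_le_lsqrt) (auto simp: power2_eq_square algebra_simps)
  ultimately show ?case
    using step assms(2)[of k] by simp
qed

section \<open>The energy estimate and the convergence rate\<close>

theorem theorem1:
  fixes f :: "'h::{real_inner, complete_space} \<Rightarrow> real"
    and g :: "'k::{real_inner, complete_space} \<Rightarrow> real"
    and K :: "'h \<Rightarrow> 'k"
    and F :: "'h \<Rightarrow> real"
    and L\<^sub>f L\<^sub>g a b :: real
    and \<rho> \<mu> L t :: "nat \<Rightarrow> real"
    and x y :: "nat \<Rightarrow> 'h"
    and x_opt :: 'h
  assumes f_convex: "convex_on UNIV f"
    and f_lipschitz: "lipschitz_on L\<^sub>f UNIV f"
    and g_convex: "convex_on UNIV g"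
    and g_lipschitz: "lipschitz_on L\<^sub>g UNIV g"
    and K_bounded_linear: "bounded_linear K"
    and F_eq: "\<And>z. F z = f z + g (K z)"
    and optimal: "\<And>z. F x_opt \<le> F z"
    and a_pos: "a > 0"
    and b_pos: "b > 0"
    and \<rho>_eq: "\<And>k. k \<ge> 1 \<Longrightarrow> \<rho> k = 1 / (a * real k)"
    and \<mu>_eq: "\<And>k. k \<ge> 1 \<Longrightarrow> \<mu> k = 1 / (b * real k)"
    and L_eq: "\<And>k. k \<ge> 1 \<Longrightarrow> L k = 1 / \<rho> k + (onorm K)\<^sup>2 / \<mu> k"
    and t_1: "t 1 = 1"
    and y_1: "y 1 = x 0"
    and x_step: "\<And>k. k \<ge> 1 \<Longrightarrow>
      x k = y k - (1 / L k) *\<^sub>R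
        (prox (1 / \<rho> k) (fenchel_conjugate (\<lambda>u. ereal (f u))) ((1 / \<rho> k) *\<^sub>R y k)
         + adjoint K
             (prox (1 / \<mu> k) (fenchel_conjugate (\<lambda>v. ereal (g v))) ((1 / \<mu> k) *\<^sub>R K (y k))))"
    and t_step: "\<And>k. k \<ge> 1 \<Longrightarrow> t (k + 1) = (1 + sqrt (1 + 4 * (t k)\<^sup>2)) / 2"
    and y_step: "\<And>k. k \<ge> 1 \<Longrightarrow>
      y (k + 1) = x k + ((t k - 1) / t (k + 1)) *\<^sub>R (x k - x (k - 1))"
  shows "(\<forall>k\<ge>1. F (x (k + 1)) - F x_opt
            \<le> 2 * (a + b * (onorm K)\<^sup>2) / (real k + 2) * (norm (x 0 - x_opt))\<^sup>2
              + 2 * (1 + ln (real k + 1)) / (real k + 2) * (L\<^sub>f\<^sup>2 / a + L\<^sub>g\<^sup>2 / b))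
       \<and> (\<lambda>k. F (x k) - F x_opt) \<in> O(\<lambda>k. ln (real k) / real k)"
proof -
  define c where "c = a + b * (onorm K)\<^sup>2"
  define C where "C = L\<^sub>f\<^sup>2 / a + L\<^sub>g\<^sup>2 / b"
  define D where "D = (norm (x 0 - x_opt))\<^sup>2"
  define \<Phi> where "\<Phi> k z = smoothing (\<rho> k) f z + smoothing (\<mu> k) g (K z)" for k z
  define G where "G k = smoothing_grad (\<rho> k) f (y k) + adjoint K (smoothing_grad (\<mu> k) g (K (y k)))" for k
  define \<epsilon> where "\<epsilon> k = \<rho> k * L\<^sub>f\<^sup>2 / 2 + \<mu> k * L\<^sub>g\<^sup>2 / 2" for k
  define \<Delta> where "\<Delta> k = \<Phi> k (x k) + \<epsilon> k - F x_opt" for k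
  define u where "u k = t k *\<^sub>R x k - (t k - 1) *\<^sub>R x (k - 1) - x_opt" for k
  interpret K: bounded_linear K by (rule K_bounded_linear)
  have c_pos: "c > 0"
    unfolding c_def using a_pos b_pos by (intro add_pos_nonneg) auto
  have C_nonneg: "C \<ge> 0" unfolding C_def using a_pos b_pos by simp
  have \<rho>_pos: "\<rho> k > 0" and \<mu>_pos: "\<mu> k > 0" if "k \<ge> 1" for k
    using that a_pos b_pos by (simp_all add: \<rho>_eq \<mu>_eq)
  have L: "L k = c * real k" if "k \<ge> 1" for k
    using that by (simp add: L_eq \<rho>_eq \<mu>_eq c_def algebra_simps)
  have \<epsilon>: "\<epsilon> k = C / (2 * real k)" if "k \<ge> 1" for k
    using that a_pos b_pos by (simp add: \<epsilon>_def \<rho>_eq \<mu>_eq C_def field_simps)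
  have inner_G: "G k \<bullet> z = smoothing_grad (\<rho> k) f (y k) \<bullet> z + smoothing_grad (\<mu> k) g (K (y k)) \<bullet> K z" for k z
    unfolding G_def
    using inner_adjoint_Hilbert[OF K_bounded_linear, of z "smoothing_grad (\<mu> k) g (K (y k))"]
    by (simp add: inner_add_left) (metis inner_commute)
  \<comment> \<open>Smoothness constants add: composing with \<open>K\<close> multiplies the
    constant \<open>1 / \<mu> k\<close> by \<open>(onorm K)\<^sup>2\<close>.\<close>
  have upper: "\<Phi> k z \<le> \<Phi> k (y k) + G k \<bullet> (z - y k) + L k / 2 * (norm (z - y k))\<^sup>2" if "k \<ge> 1" for k z
  proof -
    have "(norm (K (z - y k)))\<^sup>2 \<le> (onorm K * norm (z - y k))\<^sup>2"
      by (intro power_mono onorm[OF K_bounded_linear]) auto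
    then have "(norm (K (z - y k)))\<^sup>2 / (2 * \<mu> k) \<le> (onorm K)\<^sup>2 * (norm (z - y k))\<^sup>2 / (2 * \<mu> k)"
      using \<mu>_pos[OF that] by (intro divide_right_mono) (auto simp: power_mult_distrib)
    then show ?thesis
      using smoothing_quadratic_upper_bound[OF f_convex f_lipschitz \<rho>_pos[OF that], of z "y k"]
        smoothing_quadratic_upper_bound[OF g_convex g_lipschitz \<mu>_pos[OF that], of "K z" "K (y k)"]
      unfolding \<Phi>_def inner_G K.diff[symmetric] L_eq[OF that]
      by (simp add: distrib_right add_divide_distrib)
  qed
  have lower: "\<Phi> k (y k) + G k \<bullet> (z - y k) \<le> \<Phi> k z" if "k \<ge> 1" for k z
    using smoothing_linear_lower_bound[OF f_convex f_lipschitz \<rho>_pos[OF that], of "y k" z]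
      smoothing_linear_lower_bound[OF g_convex g_lipschitz \<mu>_pos[OF that], of "K (y k)" "K z"]
    unfolding \<Phi>_def inner_G K.diff by linarith
  have \<Phi>_le: "\<Phi> k z \<le> F z" if "k \<ge> 1" for k z
    using smoothing_le[OF f_convex f_lipschitz \<rho>_pos[OF that], of z z]
      smoothing_le[OF g_convex g_lipschitz \<mu>_pos[OF that], of "K z" "K z"]
    by (simp add: \<Phi>_def F_eq)
  have gap_le: "F (x k) - F x_opt \<le> \<Delta> k" if "k \<ge> 1" for k
    using le_smoothing[OF f_convex f_lipschitz \<rho>_pos[OF that], of "x k"]
      le_smoothing[OF g_convex g_lipschitz \<mu>_pos[OF that], of "K (x k)"]
    by (simp add: \<Phi>_def \<Delta>_def \<epsilon>_def F_eq)
  have \<Delta>_nonneg: "\<Delta> k \<ge> 0" if "k \<ge> 1" for k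
    using gap_le[OF that] optimal[of "x k"] by linarith
  have change: "\<Phi> (Suc k) z + \<epsilon> (Suc k) \<le> \<Phi> k z + \<epsilon> k" if "k \<ge> 1" for k z
  proof -
    have "\<rho> (Suc k) \<le> \<rho> k" "\<mu> (Suc k) \<le> \<mu> k"
      using that a_pos b_pos by (simp_all add: \<rho>_eq \<mu>_eq frac_le)
    then show ?thesis
      using smoothing_parameter_change[OF f_convex f_lipschitz \<rho>_pos, of "Suc k" "\<rho> k" z]
        smoothing_parameter_change[OF g_convex g_lipschitz \<mu>_pos, of "Suc k" "\<mu> k" "K z"]
      by (simp add: \<Phi>_def \<epsilon>_def left_diff_distrib diff_divide_distrib)
  qed
  have t_ge: "(real k + 1) / 2 \<le> t k" and t_le: "t k \<le> real k" if "k \<ge> 1" for k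
    using fista_parameter_bounds[of t, OF t_1 t_step that] by auto
  have t_sq: "(t (Suc k))\<^sup>2 - t (Suc k) = (t k)\<^sup>2" if "k \<ge> 1" for k
    using fista_parameter_identity[of t, OF t_step that] by simp
  \<comment> \<open>Splitting \<open>t\<^sup>2 * \<epsilon>\<close> as
    \<open>(t\<^sup>2 - t) * \<epsilon> + t * \<epsilon>\<close> shifts both gaps by
    \<open>\<epsilon> k\<close>. The rest \<open>t k * \<epsilon> k\<close> is at most
    \<open>k * \<epsilon> k = C / 2\<close>.\<close>
  have descent: "(t k)\<^sup>2 * \<Delta> k + c * real k / 2 * (norm (u k))\<^sup>2
      \<le> ((t k)\<^sup>2 - t k) * (\<Phi> k (x (k - 1)) + \<epsilon> k - F x_opt) + C / 2
        + c * real k / 2 * (norm (t k *\<^sub>R y k - (t k - 1) *\<^sub>R x (k - 1) - x_opt))\<^sup>2" if "k \<ge> 1" for k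
  proof -
    have "t k \<ge> 1" using t_ge[OF that] that by simp
    have "t k * \<Phi> k x_opt \<le> t k * F x_opt"
      using \<open>t k \<ge> 1\<close> by (intro mult_left_mono \<Phi>_le that) simp
    moreover have "t k * \<epsilon> k \<le> C / 2"
    proof -
      have "t k * \<epsilon> k \<le> real k * \<epsilon> k"
        using C_nonneg that by (intro mult_right_mono t_le) (auto simp: \<epsilon>)
      also have "\<dots> = C / 2" using that by (simp add: \<epsilon>)
      finally show ?thesis .
    qed
    moreover have "x k = y k - (1 / L k) *\<^sub>R G k"
      using x_step[OF that] by (simp add: G_def smoothing_grad_def)
    ultimately show ?thesis
      using accelerated_gradient_step[of "L k" "t k" "x k" "y k" "G k" "\<Phi> k" "x (k - 1)" x_opt,
          OF _ \<open>t k \<ge> 1\<close> _ upper[OF that] lower[OF that]] c_pos that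
      by (simp add: \<Delta>_def u_def L algebra_simps)
  qed
  have energy: "(t k)\<^sup>2 * \<Delta> k / real k + c / 2 * (norm (u k))\<^sup>2 \<le> c / 2 * D + C / 2 * harm k"
    if "k \<ge> 1" for k
    using that
  proof (induction k rule: dec_induct)
    \<comment> \<open>As \<open>t 1 = 1\<close>, the weight of the old gap vanishes and the norm on
      the right is that of \<open>x 0 - x_opt\<close>.\<close>
    case base
    then show ?case
      using descent[of 1] t_1 y_1 by (simp add: D_def harm_expand)
  next
    case (step k)
    have "t (Suc k) \<noteq> 0" using t_ge[of "Suc k"] by simp
    then have "t (Suc k) *\<^sub>R y (Suc k) = t (Suc k) *\<^sub>R x k + (t k - 1) *\<^sub>R (x k - x (k - 1))"
      using y_step[OF step(1)] by (simp add: scaleR_add_right)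
    \<comment> \<open>The extrapolation is designed so that the vector entering step
      \<open>k + 1\<close> is the one leaving step \<open>k\<close>.\<close>
    then have u_k: "t (Suc k) *\<^sub>R y (Suc k) - (t (Suc k) - 1) *\<^sub>R x k - x_opt = u k"
      by (simp add: u_def algebra_simps)
    have "((t (Suc k))\<^sup>2 - t (Suc k)) * (\<Phi> (Suc k) (x k) + \<epsilon> (Suc k) - F x_opt) \<le> (t k)\<^sup>2 * \<Delta> k"
      unfolding t_sq[OF step(1)] \<Delta>_def using change[OF step(1), of "x k"]
      by (intro mult_left_mono) auto
    \<comment> \<open>Nonnegativity of the gap pays for passing from the weight \<open>1 / k\<close>
      to \<open>1 / (k + 1)\<close>.\<close>
    moreover have "(t k)\<^sup>2 * \<Delta> k \<le> real (Suc k) * ((t k)\<^sup>2 * \<Delta> k / real k)"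
      using step(1) \<Delta>_nonneg[OF step(1)] by (simp add: field_simps)
    ultimately have "(t (Suc k))\<^sup>2 * \<Delta> (Suc k) + c * real (Suc k) / 2 * (norm (u (Suc k)))\<^sup>2
        \<le> real (Suc k) * ((t k)\<^sup>2 * \<Delta> k / real k) + C / 2 + c * real (Suc k) / 2 * (norm (u k))\<^sup>2"
      using descent[of "Suc k"] unfolding diff_Suc_1 u_k by simp
    \<comment> \<open>Dividing by \<open>k + 1\<close> makes the norm coefficient independent of the
      step and turns \<open>C / 2\<close> into the next harmonic term.\<close>
    then have "((t (Suc k))\<^sup>2 * \<Delta> (Suc k) + c * real (Suc k) / 2 * (norm (u (Suc k)))\<^sup>2) / real (Suc k)
        \<le> (real (Suc k) * ((t k)\<^sup>2 * \<Delta> k / real k) + C / 2 + c * real (Suc k) / 2 * (norm (u k))\<^sup>2) / real (Suc k)"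
      by (rule divide_right_mono) simp
    then have "(t (Suc k))\<^sup>2 * \<Delta> (Suc k) / real (Suc k) + c / 2 * (norm (u (Suc k)))\<^sup>2
        \<le> (t k)\<^sup>2 * \<Delta> k / real k + C / 2 * (1 / real (Suc k)) + c / 2 * (norm (u k))\<^sup>2"
      by (simp add: add_divide_distrib del: of_nat_Suc)
    then show ?case
      using step.IH by (simp add: harm_Suc distrib_left inverse_eq_divide)
  qed
  have bound: "F (x k) - F x_opt \<le> 2 * c / (real k + 1) * D + 2 * (1 + ln (real k)) / (real k + 1) * C"
    if "k \<ge> 1" for k
  proof -
    let ?R = "c / 2 * D + C / 2 * (1 + ln (real k))"
    \<comment> \<open>The sequence \<open>harm k - ln k\<close> is decreasing and equals 1 at
      \<open>k = 1\<close>.\<close>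
    have "harm k \<le> 1 + ln (real k)"
      using euler_mascheroni_sequence_decreasing[of 1 k] that by (simp add: harm_expand)
    then have "C / 2 * harm k \<le> C / 2 * (1 + ln (real k))"
      using C_nonneg by (intro mult_left_mono) auto
    moreover have "0 \<le> c / 2 * (norm (u k))\<^sup>2" using c_pos by simp
    ultimately have R: "(t k)\<^sup>2 * \<Delta> k / real k \<le> ?R"
      using energy[OF that] by linarith
    have "((real k + 1) / 2)\<^sup>2 * \<Delta> k \<le> (t k)\<^sup>2 * \<Delta> k"
      using t_ge[OF that] \<Delta>_nonneg[OF that] by (intro mult_right_mono power_mono) auto
    also have "\<dots> \<le> real k * ?R"
      using R that by (simp add: field_simps)
    also have "\<dots> \<le> (real k + 1) * ?R"
      using c_pos C_nonneg that by (intro mult_right_mono add_nonneg_nonneg mult_nonneg_nonneg) (auto simp: D_def)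
    finally have "(real k + 1) * ((real k + 1) * \<Delta> k) \<le> (real k + 1) * (4 * ?R)"
      by (simp add: power2_eq_square)
    then have "(real k + 1) * \<Delta> k \<le> 4 * ?R"
      by (rule mult_left_le_imp_le) simp
    then have "\<Delta> k \<le> 4 * ?R / (real k + 1)"
      by (simp add: pos_le_divide_eq mult.commute)
    also have "\<dots> = 2 * c / (real k + 1) * D + 2 * (1 + ln (real k)) / (real k + 1) * C"
    proof -
      have "4 * ?R = 2 * c * D + 2 * (1 + ln (real k)) * C"
        by (simp add: algebra_simps)
      then show ?thesis
        by (simp only: add_divide_distrib times_divide_eq_left)
    qed
    finally show ?thesis using gap_le[OF that] by linarith
  qed
  have "\<forall>\<^sub>F k in sequentially. norm (F (x k) - F x_opt) \<le> (2 * c * D + 4 * C) * norm (ln (real k) / real k)"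
    using eventually_ge_at_top[of 3]
  proof eventually_elim
    case (elim k)
    \<comment> \<open>From \<open>k \<ge> 3 \<ge> exp 1\<close> on, the constants can be absorbed
      into the logarithm.\<close>
    have "1 \<le> ln (real k)"
      using elim exp_le by (simp add: ln_ge_iff)
    then have "2 * c * D * 1 + C * (2 * (1 + ln (real k))) \<le> 2 * c * D * ln (real k) + C * (4 * ln (real k))"
      using c_pos C_nonneg by (intro add_mono mult_left_mono) (auto simp: D_def)
    then have "(2 * c * D * 1 + C * (2 * (1 + ln (real k)))) / (real k + 1)
        \<le> (2 * c * D * ln (real k) + C * (4 * ln (real k))) / real k"
      using elim \<open>1 \<le> ln (real k)\<close> c_pos C_nonneg by (intro frac_le) (auto simp: D_def)
    moreover have "F (x k) - F x_opt \<le> (2 * c * D * 1 + C * (2 * (1 + ln (real k)))) / (real k + 1)"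
      using bound[of k] elim by (simp add: add_divide_distrib distrib_left mult_ac)
    ultimately have "F (x k) - F x_opt \<le> (2 * c * D + 4 * C) * (ln (real k) / real k)"
      by (simp add: algebra_simps add_divide_distrib)
    then show ?case
      using optimal[of "x k"] \<open>1 \<le> ln (real k)\<close> by simp
  qed
  then have "(\<lambda>k. F (x k) - F x_opt) \<in> O(\<lambda>k. ln (real k) / real k)"
    by (rule bigoI)
  moreover have "F (x (k + 1)) - F x_opt \<le> 2 * c / (real k + 2) * D + 2 * (1 + ln (real k + 1)) / (real k + 2) * C"
    for k
    using bound[of "k + 1"] by (simp add: add_ac)
  ultimately show ?thesis
    unfolding c_def D_def C_def by blast
qed

end
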